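(* Let $1<p<\infty$. For every fixed integer $n\geqslant0$, the sets $\Lambda_n^{\mathrm{even}}=\{2m+in: m\in\mathbb Z\}$ and $\Lambda_n^{\mathrm{odd}}=\{2m+1+in: m\in\mathbb Z\}$ are uniqueness sets for $H^p$. Namely, given $f\in H^p$, if either $f|_{\Lambda_n^{\mathrm{even}}}\equiv0$ or $f|_{\Lambda_n^{\mathrm{odd}}}\equiv0$, then $f\equiv0$ on $\mathbb Z^2_+$.
   Context: Lattice points $(m,n)\in\mathbb Z^2$ are identified with $m+in\in\mathbb C$. Let $\mathbb Z^2_+=\{m+in: m,n\in\mathbb Z,\ n\geqslant 0\}$. A function $f:\mathbb Z^2_+\to\mathbb C$ is discrete holomorphic, written $f\in\operatorname{Hol}(\mathbb Z^2_+)$, if $f(z)+i f(z+1)-f(z+1+i)-i f(z+i)=0$ for every $z\in\mathbb Z^2_+$. For $1\leqslant p\leqslant\infty$, $H^p=H^p(\mathbb Z^2_+)=\{f\in\operatorname{Hol}(\mathbb Z^2_+): \|f\|_{H^p}:=\sup_{n\geqslant 0}\|f(\cdot+in)\|_{\ell^p(\mathbb Z)}<\infty\}$. *)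

theory Defs
  imports "HOL-Analysis.Analysis"
begin

text \<open>The lattice point \<open>(m, n)\<close>, regarded as the complex number \<open>m + i n\<close>.\<close>

definition lattice_pt :: "int \<Rightarrow> nat \<Rightarrow> complex" where
  "lattice_pt m n = of_int m + \<i> * of_nat n"

definition Z2_plus :: "complex set" where
  "Z2_plus = {lattice_pt m n | m n. True}"

text \<open>A function on \<open>Z2_plus\<close> is represented by a total function on the complex numbers.
  Its values off the lattice are arbitrary and never used.\<close>

definition Hol :: "(complex \<Rightarrow> complex) set" where
  "Hol = {f. \<forall>z\<in>Z2_plus. f z + \<i> * f (z + 1) - f (z + 1 + \<i>) - \<i> * f (z + \<i>) = 0}"

text \<open>The \<open>l^p\<close> norm on the integers for \<open>1 \<le> p \<le> \<infinity>\<close>, with values in \<open>[0, \<infinity>]\<close>.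
  The root of the sum is taken in the reals, hence the case distinction for a divergent sum.\<close>

definition ell_norm :: "ennreal \<Rightarrow> (int \<Rightarrow> complex) \<Rightarrow> ennreal" where
  "ell_norm p g =
    (if p = \<infinity> then (SUP m. ennreal (cmod (g m)))
     else let S = (\<Sum>\<^sub>\<infinity>m\<in>UNIV. ennreal (cmod (g m) powr enn2real p))
          in if S = \<infinity> then \<infinity> else ennreal (enn2real S powr (1 / enn2real p)))"

definition Hp_norm :: "ennreal \<Rightarrow> (complex \<Rightarrow> complex) \<Rightarrow> ennreal" where
  "Hp_norm p f = (SUP n. ell_norm p (\<lambda>m. f (lattice_pt m n)))"

definition Hp :: "ennreal \<Rightarrow> (complex \<Rightarrow> complex) set" where
  "Hp p = {f \<in> Hol. Hp_norm p f < \<infinity>}"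

definition Lambda_even :: "nat \<Rightarrow> complex set" where
  "Lambda_even n = {lattice_pt (2 * m) n | m. True}"

definition Lambda_odd :: "nat \<Rightarrow> complex set" where
  "Lambda_odd n = {lattice_pt (2 * m + 1) n | m. True}"

definition uniqueness_set :: "(complex \<Rightarrow> complex) set \<Rightarrow> complex set \<Rightarrow> bool" where
  "uniqueness_set X \<Lambda> \<longleftrightarrow>
    \<Lambda> \<subseteq> Z2_plus \<and> (\<forall>f\<in>X. (\<forall>z\<in>\<Lambda>. f z = 0) \<longrightarrow> (\<forall>z\<in>Z2_plus. f z = 0))"

end

theory Submission
  imports Defs
begin

text \<open>
  Fix a row on which \<open>f\<close> vanishes at all even (or all odd) points. Multiplication by \<open>(-1)\<^sup>m\<close>
  changes that row at most by a sign, and it turns the discrete Cauchy-Riemann equation into the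
  same equation with the vertical direction reversed, up to alternating signs of the rows. Hence
  the restriction of \<open>f\<close> to the rows above extends by reflection to a bounded discrete holomorphic
  function on the whole lattice. Such a function is harmonic with respect to the four diagonal
  neighbours, and Liouville's theorem makes it invariant under diagonal steps, so the row is
  2-periodic; being in \<open>\<ell>\<^sup>p\<close>, it is zero. If one row is zero, every adjacent row has constant modulus
  and vanishes for the same reason.
\<close>

section \<open>Liouville theorem and reflection on the whole lattice\<close>

definition discrete_holomorphic :: "(int \<Rightarrow> int \<Rightarrow> complex) \<Rightarrow> bool" where
  "discrete_holomorphic F \<longleftrightarrow>
    (\<forall>m n. F m n + \<i> * F (m + 1) n - F (m + 1) (n + 1) - \<i> * F m (n + 1) = 0)"

text \<open>The value type is generic so that the notion covers complex functions as well as their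
  real and imaginary parts.\<close>

definition diag_harmonic :: "(int \<Rightarrow> int \<Rightarrow> 'a::real_vector) \<Rightarrow> bool" where
  "diag_harmonic u \<longleftrightarrow> (\<forall>m n. u (m + 1) (n + 1) + u (m - 1) (n + 1) + u (m + 1) (n - 1)
    + u (m - 1) (n - 1) = 4 *\<^sub>R u m n)"

text \<open>The Cauchy-Riemann equations on the four unit squares meeting at \<open>(m, n)\<close>
  are combined with coefficients 1, -1, i, -i. The four axis neighbours cancel, and only the centre
  and the diagonal neighbours remain.\<close>

lemma discrete_holomorphic_diag_harmonic:
  assumes "discrete_holomorphic F"
  shows "diag_harmonic F"
  unfolding diag_harmonic_def
proof (intro allI)
  fix m n
  have 1: "F m n + \<i> * F (m + 1) n - F (m + 1) (n + 1) - \<i> * F m (n + 1) = 0"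
    and 2: "F (m - 1) (n - 1) + \<i> * F m (n - 1) - F m n - \<i> * F (m - 1) n = 0"
    and 3: "F m (n - 1) + \<i> * F (m + 1) (n - 1) - F (m + 1) n - \<i> * F m n = 0"
    and 4: "F (m - 1) n + \<i> * F m n - F m (n + 1) - \<i> * F (m - 1) (n + 1) = 0"
    using assms[unfolded discrete_holomorphic_def, rule_format, of m n]
      assms[unfolded discrete_holomorphic_def, rule_format, of "m - 1" "n - 1"]
      assms[unfolded discrete_holomorphic_def, rule_format, of m "n - 1"]
      assms[unfolded discrete_holomorphic_def, rule_format, of "m - 1" n]
    by simp_all
  have "4 * F m n - (F (m + 1) (n + 1) + F (m - 1) (n + 1) + F (m + 1) (n - 1) + F (m - 1) (n - 1))
    = (F m n + \<i> * F (m + 1) n - F (m + 1) (n + 1) - \<i> * F m (n + 1))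
      - (F (m - 1) (n - 1) + \<i> * F m (n - 1) - F m n - \<i> * F (m - 1) n)
      + \<i> * (F m (n - 1) + \<i> * F (m + 1) (n - 1) - F (m + 1) n - \<i> * F m n)
      - \<i> * (F (m - 1) n + \<i> * F m n - F m (n + 1) - \<i> * F (m - 1) (n + 1))"
    by (simp add: algebra_simps)
  then show "F (m + 1) (n + 1) + F (m - 1) (n + 1) + F (m + 1) (n - 1) + F (m - 1) (n - 1)
    = 4 *\<^sub>R F m n"
    unfolding 1 2 3 4 by (simp add: scaleR_conv_of_real)
qed

text \<open>The diagonal increment of \<open>u\<close> is again harmonic and bounded. If its
  supremum \<open>S\<close> were positive, a near-maximal increment would force near-maximal
  increments at many successive diagonal points, and their telescoping sum would exceed the
  oscillation of \<open>u\<close>.\<close>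

lemma diag_harmonic_diff_nonpos:
  fixes u :: "int \<Rightarrow> int \<Rightarrow> real"
  assumes harm: "diag_harmonic u" and bd: "\<And>m n. \<bar>u m n\<bar> \<le> C"
  shows "u (m + 1) (n + 1) \<le> u m n"
proof (rule ccontr)
  assume neg: "\<not> u (m + 1) (n + 1) \<le> u m n"
  define d where "d = (\<lambda>(m, n). u (m + 1) (n + 1) - u m n)"
  define S where "S = (SUP x. d x)"
  have "d x \<le> 2 * C" for x
    using bd[of "fst x + 1" "snd x + 1"] bd[of "fst x" "snd x"]
    by (simp add: d_def split_beta)
  then have bdd: "bdd_above (range d)"
    by (intro bdd_aboveI) auto
  have le_S: "d x \<le> S" for x
    unfolding S_def by (rule cSUP_upper) (use bdd in auto)
  have S_pos: "S > 0"
    using le_S[of "(m, n)"] neg by (simp add: d_def)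
  have d_harm: "4 * d (a, b) = d (a + 1, b + 1) + d (a - 1, b + 1) + d (a + 1, b - 1) + d (a - 1, b - 1)"
    for a b
    using harm[unfolded diag_harmonic_def, rule_format, of a b]
      harm[unfolded diag_harmonic_def, rule_format, of "a + 1" "b + 1"]
    by (simp add: d_def algebra_simps)
  \<comment> \<open>Two values of \<open>u\<close> differ by at most \<open>2 * C\<close>, so
    \<open>N\<close> diagonal steps that each gain at least \<open>S / 2\<close> are
    impossible.\<close>
  obtain N :: nat where N: "N * (S / 2) > 2 * C"
    using reals_Archimedean3[of "S / 2"] S_pos by (meson half_gt_zero)
  \<comment> \<open>The defect from \<open>S\<close> can grow fourfold per step; this starting
    defect keeps it at most \<open>S / 2\<close> along the whole chain.\<close>
  define e where "e = S / 2 / 4 ^ N"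
  have "S - e < S"
    using S_pos by (simp add: e_def)
  then obtain x where "S - e < d x"
    using less_cSUP_iff[of UNIV d "S - e"] bdd by (auto simp: S_def)
  then obtain a b where ab: "S - e < d (a, b)"
    by (cases x) auto
  have near: "S - 4 ^ k * e \<le> d (a + int k, b + int k)" for k
  proof (induction k)
    case 0
    then show ?case using ab by simp
  next
    case (Suc k)
    \<comment> \<open>The other three neighbours are at most \<open>S\<close>, so the whole defect
      falls on the next diagonal point.\<close>
    have "4 * d (a + int k, b + int k) \<le> d (a + int (Suc k), b + int (Suc k)) + 3 * S"
      using d_harm[of "a + int k" "b + int k"]
        le_S[of "(a + int k - 1, b + int k + 1)"] le_S[of "(a + int k + 1, b + int k - 1)"]
        le_S[of "(a + int k - 1, b + int k - 1)"]
      by (simp add: algebra_simps)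
    then show ?case using Suc by simp
  qed
  have "S / 2 \<le> d (a + int k, b + int k)" if "k < N" for k
  proof -
    have "(4::real) ^ k \<le> 4 ^ N"
      using that by (intro power_increasing) auto
    then have "4 ^ k * e \<le> S / 2"
      using S_pos by (simp add: e_def field_simps)
    then show ?thesis using near[of k] by linarith
  qed
  then have "N * (S / 2) \<le> (\<Sum>k<N. d (a + int k, b + int k))"
    using sum_bounded_below[of "{..<N}" "S / 2" "\<lambda>k. d (a + int k, b + int k)"] by simp
  also have "\<dots> = (\<Sum>k<N. u (a + int (Suc k)) (b + int (Suc k)) - u (a + int k) (b + int k))"
    by (simp add: d_def algebra_simps)
  also have "\<dots> = u (a + int N) (b + int N) - u a b"
    by (subst sum_lessThan_telescope) simp
  also have "\<dots> \<le> 2 * C"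
    using bd[of "a + int N" "b + int N"] bd[of a b] by linarith
  finally show False using N by linarith
qed

text \<open>The reverse inequality comes from \<open>- u\<close>, and the other diagonal direction
  from reflecting the second coordinate.\<close>

lemma diag_harmonic_bounded_invariant:
  fixes u :: "int \<Rightarrow> int \<Rightarrow> real"
  assumes harm: "diag_harmonic u" and bd: "\<And>m n. \<bar>u m n\<bar> \<le> C"
  shows "u (m + 1) (n + 1) = u m n" "u (m + 1) (n - 1) = u m n"
proof -
  have inv: "v (m + 1) (n + 1) = v m n"
    if "diag_harmonic v" "\<And>m n. \<bar>v m n\<bar> \<le> C" for v :: "int \<Rightarrow> int \<Rightarrow> real" and m n
  proof (rule antisym)
    have "diag_harmonic (\<lambda>m n. - v m n)"
      unfolding diag_harmonic_def
      using that(1)[unfolded diag_harmonic_def] by (simp add: algebra_simps)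
    from diag_harmonic_diff_nonpos[OF this, of C m n] that(2)
    show "v m n \<le> v (m + 1) (n + 1)" by simp
  qed (rule diag_harmonic_diff_nonpos[OF that])
  show "u (m + 1) (n + 1) = u m n"
    by (rule inv[OF assms])
  have "diag_harmonic (\<lambda>m n. u m (- n))"
    unfolding diag_harmonic_def
  proof (intro allI)
    fix m n
    show "u (m + 1) (- (n + 1)) + u (m - 1) (- (n + 1)) + u (m + 1) (- (n - 1)) + u (m - 1) (- (n - 1))
      = 4 *\<^sub>R u m (- n)"
      using harm[unfolded diag_harmonic_def, rule_format, of m "- n"]
      by (simp add: algebra_simps minus_diff_commute)
  qed
  from inv[OF this, of m "- n"] bd show "u (m + 1) (n - 1) = u m n" by simp
qed

text \<open>A diagonal step up followed by one down is a horizontal shift by two.\<close>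

lemma discrete_holomorphic_bounded_periodic:
  assumes hol: "discrete_holomorphic F" and bd: "\<And>m n. cmod (F m n) \<le> C"
  shows "F (m + 2) n = F m n"
proof -
  have harm: "diag_harmonic F"
    by (rule discrete_holomorphic_diag_harmonic[OF hol])
  have period: "u (m + 2) n = u m n" if "diag_harmonic u" "\<And>m n. \<bar>u m n\<bar> \<le> C"
    for u :: "int \<Rightarrow> int \<Rightarrow> real"
    using diag_harmonic_bounded_invariant(1)[OF that, of m n]
      diag_harmonic_bounded_invariant(2)[OF that, of "m + 1" "n + 1"] by (simp add: add.commute)
  have "diag_harmonic (\<lambda>m n. Re (F m n))" "diag_harmonic (\<lambda>m n. Im (F m n))"
    using harm by (auto simp: diag_harmonic_def complex_eq_iff)
  moreover have "\<bar>Re (F m n)\<bar> \<le> C" "\<bar>Im (F m n)\<bar> \<le> C" for m n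
    using abs_Re_le_cmod[of "F m n"] abs_Im_le_cmod[of "F m n"] bd[of m n] by linarith+
  ultimately show ?thesis
    by (auto simp: complex_eq_iff intro!: period)
qed

lemma reflection_periodic:
  fixes g :: "nat \<Rightarrow> int \<Rightarrow> complex"
  assumes hol: "\<And>m n. g n m + \<i> * g n (m + 1) - g (Suc n) (m + 1) - \<i> * g (Suc n) m = 0"
    and bd: "\<And>m n. cmod (g n m) \<le> C"
    and zero: "(\<forall>m. even m \<longrightarrow> g 0 m = 0) \<or> (\<forall>m. odd m \<longrightarrow> g 0 m = 0)"
  shows "g 0 (m + 2) = g 0 m"
proof -
  define \<sigma> :: "int \<Rightarrow> complex" where "\<sigma> m = (if even m then 1 else -1)" for m
  \<comment> \<open>The twist by \<open>\<sigma>\<close> must fix row 0. If only odd entries survive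
    there, it negates them and \<open>s = -1\<close> compensates; otherwise only even entries
    survive and \<open>s = 1\<close> works.\<close>
  obtain s :: complex where s: "s = 1 \<or> s = -1" and s0: "\<And>m. s * \<sigma> m * g 0 m = g 0 m"
  proof (cases "\<forall>m. even m \<longrightarrow> g 0 m = 0")
    case True
    then show ?thesis by (intro that[of "-1"]) (auto simp: \<sigma>_def)
  next
    case False
    with zero show ?thesis by (intro that[of 1]) (auto simp: \<sigma>_def)
  qed
  define F where
    "F m k = (if k \<ge> 0 then g (nat k) m else s * (-1) ^ nat (- k) * \<sigma> m * g (nat (- k)) m)" for m k
  have F_pos: "F m (int k) = g k m" for m k
    by (simp add: F_def)
  \<comment> \<open>At \<open>k = 0\<close> the definition of \<open>F\<close> takes its other
    branch; \<open>s0\<close> makes the reflected formula valid there too, so the squares just below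
    the axis need no separate case.\<close>
  have F_neg: "F m (- int k) = s * (-1) ^ k * \<sigma> m * g k m" for m k
    using s0[of m] by (cases k) (auto simp: F_def simp del: of_nat_Suc)
  have "discrete_holomorphic F"
    unfolding discrete_holomorphic_def
  proof (intro allI)
    fix m k
    show "F m k + \<i> * F (m + 1) k - F (m + 1) (k + 1) - \<i> * F m (k + 1) = 0"
    proof (cases "k \<ge> 0")
      case True
      then obtain j where j: "k = int j" by (rule nonneg_int_cases)
      have "int j + 1 = int (Suc j)" by simp
      then show ?thesis
        using hol[of j m] by (simp only: j F_pos)
    next
      case False
      then obtain j where j: "k + 1 = - int j" "k = - int (Suc j)"
        by (intro that[of "nat (- k - 1)"]) auto
      have \<sigma>: "\<sigma> (m + 1) = - \<sigma> m" by (simp add: \<sigma>_def)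
      \<comment> \<open>On a square below the axis the Cauchy-Riemann expression is a multiple of
        the one on its mirror image.\<close>
      have "F m k + \<i> * F (m + 1) k - F (m + 1) (k + 1) - \<i> * F m (k + 1)
        = - \<i> * (s * (-1) ^ j * \<sigma> m)
          * (g j m + \<i> * g j (m + 1) - g (Suc j) (m + 1) - \<i> * g (Suc j) m)"
        unfolding j(1) unfolding j(2) F_neg \<sigma> by (simp add: algebra_simps)
      then show ?thesis by (simp only: hol mult_zero_right)
    qed
  qed
  moreover have "cmod (F m k) \<le> C" for m k
    using bd s by (auto simp: F_def \<sigma>_def norm_mult norm_power)
  ultimately have "F (m + 2) 0 = F m 0"
    by (rule discrete_holomorphic_bounded_periodic)
  then show ?thesis by (simp add: F_def)
qed

section \<open>Rows of finite \<open>ell_norm\<close>\<close>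

lemma finite_sum_le_infsum_ennreal:
  fixes h :: "'a \<Rightarrow> ennreal"
  assumes "finite B"
  shows "sum h B \<le> infsum h UNIV"
  by (subst nonneg_infsum_complete) (use assms in \<open>auto intro!: SUP_upper\<close>)

lemma ell_norm_finite_imp_infsum_finite:
  assumes "p \<noteq> \<infinity>" "ell_norm p g < \<infinity>"
  shows "(\<Sum>\<^sub>\<infinity>m\<in>UNIV. ennreal (cmod (g m) powr enn2real p)) < \<infinity>"
  using assms by (auto simp: ell_norm_def Let_def less_top split: if_splits)

text \<open>This turns a finite \<open>Hp_norm\<close> into the uniform bound required by
  Liouville's theorem.\<close>

lemma ell_norm_ge_cmod:
  assumes "0 < p" "p \<noteq> \<infinity>"
  shows "ennreal (cmod (g m)) \<le> ell_norm p g"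
proof -
  define S where "S = (\<Sum>\<^sub>\<infinity>m\<in>UNIV. ennreal (cmod (g m) powr enn2real p))"
  have p: "enn2real p > 0"
    using assms by (simp add: enn2real_positive_iff less_top)
  show ?thesis
  proof (cases "S = \<infinity>")
    case True
    then show ?thesis using assms by (simp add: ell_norm_def S_def)
  next
    case False
    have "ennreal (cmod (g m) powr enn2real p) \<le> S"
      unfolding S_def
      using finite_sum_le_infsum_ennreal[of "{m}" "\<lambda>m. ennreal (cmod (g m) powr enn2real p)"]
      by simp
    then have "cmod (g m) powr enn2real p \<le> enn2real S"
      using False enn2real_mono[of "ennreal (cmod (g m) powr enn2real p)" S] by (simp add: less_top)
    then have "(cmod (g m) powr enn2real p) powr (1 / enn2real p) \<le> enn2real S powr (1 / enn2real p)"
      using p by (intro powr_mono2) auto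
    then have "cmod (g m) \<le> enn2real S powr (1 / enn2real p)"
      using p by (simp add: powr_powr)
    then show ?thesis
      using assms False by (simp add: ell_norm_def S_def Let_def ennreal_leI)
  qed
qed

text \<open>A nonzero entry would repeat its modulus infinitely often and make the sum diverge.
  Periodicity is asked only of the modulus, so that rows whose entries rotate by powers of i are
  covered.\<close>

lemma ell_norm_finite_periodic_zero:
  assumes p: "p \<noteq> \<infinity>" and fin: "ell_norm p g < \<infinity>"
    and per: "\<And>m. cmod (g (m + 2)) = cmod (g m)"
  shows "g m = 0"
proof (rule ccontr)
  assume nz: "g m \<noteq> 0"
  define h where "h j = ennreal (cmod (g j) powr enn2real p)" for j
  define S where "S = (\<Sum>\<^sub>\<infinity>j\<in>UNIV. h j)"
  have S: "S < \<infinity>"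
    using ell_norm_finite_imp_infsum_finite[OF p fin] by (simp add: S_def h_def)
  have gk: "cmod (g (m + 2 * int k)) = cmod (g m)" for k
  proof (induction k)
    case (Suc k)
    then show ?case using per[of "m + 2 * int k"] by (simp add: algebra_simps)
  qed simp
  have le: "of_nat N * h m \<le> S" for N :: nat
  proof -
    have "of_nat N * h m = (\<Sum>j\<in>(\<lambda>k. m + 2 * int k) ` {..<N}. h j)"
      by (subst sum.reindex) (auto simp: inj_on_def h_def gk)
    also have "\<dots> \<le> S"
      unfolding S_def by (rule finite_sum_le_infsum_ennreal) simp
    finally show ?thesis .
  qed
  define c where "c = cmod (g m) powr enn2real p"
  have c: "c > 0" using nz by (simp add: c_def)
  obtain N :: nat where N: "N * c > enn2real S"
    using reals_Archimedean3[OF c] by auto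
  have "ennreal (N * c) = of_nat N * h m"
    using c by (simp add: h_def c_def ennreal_mult ennreal_of_nat_eq_real_of_nat)
  also have "\<dots> \<le> S" by (rule le)
  finally have "N * c \<le> enn2real S"
    using S c enn2real_mono[of "ennreal (N * c)" S] by simp
  then show False using N by simp
qed

section \<open>Vanishing of functions in \<open>Hp\<close>\<close>

lemma Hol_row:
  assumes "f \<in> Hol"
  shows "f (lattice_pt m n) + \<i> * f (lattice_pt (m + 1) n)
    - f (lattice_pt (m + 1) (Suc n)) - \<i> * f (lattice_pt m (Suc n)) = 0"
proof -
  have "lattice_pt m n \<in> Z2_plus"
    by (auto simp: Z2_plus_def)
  moreover have "lattice_pt m n + 1 = lattice_pt (m + 1) n"
    "lattice_pt (m + 1) n + \<i> = lattice_pt (m + 1) (Suc n)"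
    "lattice_pt m n + \<i> = lattice_pt m (Suc n)"
    by (simp_all add: lattice_pt_def algebra_simps)
  ultimately show ?thesis
    using assms unfolding Hol_def by fastforce
qed

lemma Hp_row_zero_imp_zero:
  assumes f: "f \<in> Hp p" and p: "p \<noteq> \<infinity>" and zero: "\<And>m. f (lattice_pt m n) = 0"
  shows "f (lattice_pt m k) = 0"
proof -
  have hol: "f \<in> Hol" using f by (simp add: Hp_def)
  have fin: "ell_norm p (\<lambda>m. f (lattice_pt m k)) < \<infinity>" for k
    using f le_less_trans[OF SUP_upper[of k UNIV]] by (fastforce simp: Hp_def Hp_norm_def)
  have row: "f (lattice_pt m k) = 0"
    if "\<And>m. cmod (f (lattice_pt (m + 1) k)) = cmod (f (lattice_pt m k))" for m k
  proof (rule ell_norm_finite_periodic_zero[OF p fin, of k m])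
    fix j
    show "cmod (f (lattice_pt (j + 2) k)) = cmod (f (lattice_pt j k))"
      using that[of j] that[of "j + 1"] by (simp add: add.assoc)
  qed
  \<comment> \<open>Next to a zero row the Cauchy-Riemann equation keeps two terms, so consecutive
    entries differ by a factor of modulus 1.\<close>
  have up: "\<forall>m. f (lattice_pt m (Suc k)) = 0" if "\<forall>m. f (lattice_pt m k) = 0" for k
  proof
    fix m
    have "f (lattice_pt (m + 1) (Suc k)) = - \<i> * f (lattice_pt m (Suc k))" for m
      using Hol_row[OF hol, of m k] that by (simp add: eq_neg_iff_add_eq_0 minus_equation_iff add.commute)
    then show "f (lattice_pt m (Suc k)) = 0"
      by (intro row) (simp add: norm_mult)
  qed
  have down: "\<forall>m. f (lattice_pt m k) = 0" if "\<forall>m. f (lattice_pt m (Suc k)) = 0" for k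
  proof
    fix m
    have "f (lattice_pt m k) = - \<i> * f (lattice_pt (m + 1) k)" for m
      using Hol_row[OF hol, of m k] that by (simp add: eq_neg_iff_add_eq_0)
    then have "cmod (f (lattice_pt m k)) = cmod (- \<i> * f (lattice_pt (m + 1) k))" for m
      by metis
    then show "f (lattice_pt m k) = 0"
      by (intro row) (simp add: norm_mult)
  qed
  have "\<forall>m. f (lattice_pt m k) = 0"
  proof (cases "n \<le> k")
    case True
    then show ?thesis
      by (induction k rule: dec_induct) (use zero up in auto)
  next
    case False
    then have "k \<le> n" by simp
    then show ?thesis
      by (induction k rule: inc_induct) (use zero down in auto)
  qed
  then show ?thesis by blast
qed

lemma Hp_half_row_zero_imp_zero:
  assumes f: "f \<in> Hp p" and p: "0 < p" "p \<noteq> \<infinity>"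
    and zero: "(\<forall>m. even m \<longrightarrow> f (lattice_pt m n) = 0) \<or> (\<forall>m. odd m \<longrightarrow> f (lattice_pt m n) = 0)"
    and z: "z \<in> Z2_plus"
  shows "f z = 0"
proof -
  have hol: "f \<in> Hol" and fin: "Hp_norm p f < \<infinity>"
    using f by (simp_all add: Hp_def)
  have row_le: "ell_norm p (\<lambda>m. f (lattice_pt m k)) \<le> Hp_norm p f" for k
    unfolding Hp_norm_def by (rule SUP_upper) simp
  have bd: "cmod (f (lattice_pt m k)) \<le> enn2real (Hp_norm p f)" for m k
  proof -
    have "ennreal (cmod (f (lattice_pt m k))) \<le> Hp_norm p f"
      using ell_norm_ge_cmod[OF p, of "\<lambda>m. f (lattice_pt m k)" m] row_le[of k] by (rule order_trans)
    then show ?thesis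
      using fin enn2real_mono[of "ennreal (cmod (f (lattice_pt m k)))" "Hp_norm p f"] by simp
  qed
  \<comment> \<open>Rows are counted from row \<open>n\<close>, which becomes the axis of
    reflection; rows below \<open>n\<close> are reached only by the downward propagation of a zero
    row.\<close>
  have "f (lattice_pt (m + 2) n) = f (lattice_pt m n)" for m
    using reflection_periodic[of "\<lambda>k m. f (lattice_pt m (n + k))" "enn2real (Hp_norm p f)" m]
      Hol_row[OF hol] bd zero by simp
  then have "f (lattice_pt m n) = 0" for m
    using ell_norm_finite_periodic_zero[OF p(2) le_less_trans[OF row_le fin], of n m] by simp
  then have "f (lattice_pt m k) = 0" for m k
    by (rule Hp_row_zero_imp_zero[OF f p(2)])
  then show ?thesis using z by (auto simp: Z2_plus_def)
qed

theorem proposition7p1: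
  fixes p :: ennreal and n :: nat
  assumes "1 < p" and "p < \<infinity>"
  shows "uniqueness_set (Hp p) (Lambda_even n) \<and> uniqueness_set (Hp p) (Lambda_odd n)"
proof -
  have p: "0 < p" "p \<noteq> \<infinity>"
    using assms less_trans[OF zero_less_one] by auto
  have "f z = 0" if "f \<in> Hp p" "\<forall>z\<in>Lambda_even n. f z = 0" "z \<in> Z2_plus" for f z
  proof (rule Hp_half_row_zero_imp_zero[OF that(1) p _ that(3)])
    show "(\<forall>m. even m \<longrightarrow> f (lattice_pt m n) = 0) \<or> (\<forall>m. odd m \<longrightarrow> f (lattice_pt m n) = 0)"
      using that(2) by (auto simp: Lambda_even_def elim!: evenE)
  qed
  moreover have "f z = 0" if "f \<in> Hp p" "\<forall>z\<in>Lambda_odd n. f z = 0" "z \<in> Z2_plus" for f z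
  proof (rule Hp_half_row_zero_imp_zero[OF that(1) p _ that(3)])
    show "(\<forall>m. even m \<longrightarrow> f (lattice_pt m n) = 0) \<or> (\<forall>m. odd m \<longrightarrow> f (lattice_pt m n) = 0)"
      using that(2) by (auto simp: Lambda_odd_def elim!: oddE)
  qed
  moreover have "Lambda_even n \<subseteq> Z2_plus" "Lambda_odd n \<subseteq> Z2_plus"
    by (auto simp: Lambda_even_def Lambda_odd_def Z2_plus_def)
  ultimately show ?thesis
    by (auto simp: uniqueness_set_def)
qed

end
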